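(* Let $V=\mathbb{K}^2$ with quadratic form $q(x)=\alpha x_1^2+\beta x_1x_2+\gamma x_2^2$, where $\alpha,\beta,\gamma\in\mathbb{K}$ are arbitrary. \begin{enumerate} \item There exists a unique $\mathbb{K}$-trilinear map $V^3\to V$, $(x,y,z)\mapsto\langle xyz\rangle$, satisfying the Kirmse identity $\langle xxy\rangle=q(x)y=\langle yxx\rangle$ for all $x,y\in V$. \item This trilinear map is commutative, i.e. $\langle xyz\rangle=\langle zyx\rangle$ for all $x,y,z\in V$, and para-associative, i.e. $\langle ab\langle cde\rangle\rangle=\langle a\langle dcb\rangle e\rangle=\langle\langle abc\rangle de\rangle$ for all $a,b,c,d,e\in V$. \item It satisfies the ternary composition rule $q(\langle xyz\rangle)=q(x)q(y)q(z)$ for all $x,y,z\in V$. \end{enumerate} In particular, if $V^\times=\{x\in V\mid q(x)\in\mathbb{K}^\times\}$ is non-empty, $V$ is canonically a commutative group spherical space; and for every $c\in\mathbb{K}^\times$ the circle $S=\{x\in V\mid q(x)=c\}$ is stable under the map $(x,y,z)\mapsto\frac1c\langle xyz\rangle$, which defines a commutative torsor structure on $S$.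
   Context: $\mathbb{K}$ is a commutative ring with unit $1$ ($2$ is not assumed invertible). A group spherical space is a $\mathbb{K}$-module $V$ with a quadratic form $q:V\to\mathbb{K}$ such that $V^\times=\{x\in V\mid q(x)\in\mathbb{K}^\times\}\neq\emptyset$, together with a $\mathbb{K}$-trilinear map $V^3\to V$, $(x,y,z)\mapsto\langle xyz\rangle$, satisfying for all elements: the Kirmse identities $\langle xxy\rangle=q(x)y=\langle yxx\rangle$; para-associativity $\langle ab\langle cde\rangle\rangle=\langle a\langle dcb\rangle e\rangle=\langle\langle abc\rangle de\rangle$; and the ternary composition law $q(\langle xyz\rangle)=q(x)q(y)q(z)$. It is commutative if $\langle xyz\rangle=\langle zyx\rangle$ for all $x,y,z$. A torsor is a set with a ternary product $(xyz)$ satisfying idempotency $(xxy)=y=(yxx)$ and para-associativity $(ab(cde))=(a(dcb)e)=((abc)de)$ (the empty set is allowed); it is commutative if $(xyz)=(zyx)$. *)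

theory Defs
  imports "HOL-Analysis.Finite_Cartesian_Product"
begin

text \<open>The ring is a type of class \<^class>\<open>comm_ring_1\<close> and \<open>act\<close> is its action on a module, as in
  the library locale \<^locale>\<open>module\<close>; \<^term>\<open>(*)\<close> is the ring as a module over itself.\<close>

text \<open>2 may fail to be invertible, so bilinearity of the polar form is part of the definition.\<close>

definition quadratic_form ::
    "('k::comm_ring_1 \<Rightarrow> 'v::ab_group_add \<Rightarrow> 'v) \<Rightarrow> ('v \<Rightarrow> 'k) \<Rightarrow> bool" where
  "quadratic_form act q \<longleftrightarrow>
     (\<forall>a x. q (act a x) = a\<^sup>2 * q x) \<and>
     (\<forall>y. module_hom act (*) (\<lambda>x. q (x + y) - q x - q y)) \<and>
     (\<forall>x. module_hom act (*) (\<lambda>y. q (x + y) - q x - q y))"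

definition trilinear ::
    "('k::comm_ring_1 \<Rightarrow> 'v::ab_group_add \<Rightarrow> 'v) \<Rightarrow> ('v \<Rightarrow> 'v \<Rightarrow> 'v \<Rightarrow> 'v) \<Rightarrow> bool" where
  "trilinear act t \<longleftrightarrow>
     (\<forall>y z. module_hom act act (\<lambda>x. t x y z)) \<and>
     (\<forall>x z. module_hom act act (\<lambda>y. t x y z)) \<and>
     (\<forall>x y. module_hom act act (\<lambda>z. t x y z))"

definition kirmse ::
    "('k \<Rightarrow> 'v \<Rightarrow> 'v) \<Rightarrow> ('v \<Rightarrow> 'k) \<Rightarrow> ('v \<Rightarrow> 'v \<Rightarrow> 'v \<Rightarrow> 'v) \<Rightarrow> bool" where
  "kirmse act q t \<longleftrightarrow> (\<forall>x y. t x x y = act (q x) y \<and> t y x x = act (q x) y)"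

definition para_associative_on :: "'v set \<Rightarrow> ('v \<Rightarrow> 'v \<Rightarrow> 'v \<Rightarrow> 'v) \<Rightarrow> bool" where
  "para_associative_on S t \<longleftrightarrow>
     (\<forall>a\<in>S. \<forall>b\<in>S. \<forall>c\<in>S. \<forall>d\<in>S. \<forall>e\<in>S.
        t a b (t c d e) = t a (t d c b) e \<and> t a (t d c b) e = t (t a b c) d e)"

definition commutative_on :: "'v set \<Rightarrow> ('v \<Rightarrow> 'v \<Rightarrow> 'v \<Rightarrow> 'v) \<Rightarrow> bool" where
  "commutative_on S t \<longleftrightarrow> (\<forall>x\<in>S. \<forall>y\<in>S. \<forall>z\<in>S. t x y z = t z y x)"

definition ternary_composition ::
    "('v \<Rightarrow> 'k::times) \<Rightarrow> ('v \<Rightarrow> 'v \<Rightarrow> 'v \<Rightarrow> 'v) \<Rightarrow> bool" where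
  "ternary_composition q t \<longleftrightarrow> (\<forall>x y z. q (t x y z) = q x * q y * q z)"

definition invertible_elements :: "('v \<Rightarrow> 'k::comm_ring_1) \<Rightarrow> 'v set" where
  "invertible_elements q = {x. q x dvd 1}"

locale group_spherical_space = module act
  for act :: "'k::comm_ring_1 \<Rightarrow> 'v::ab_group_add \<Rightarrow> 'v" +
  fixes q :: "'v \<Rightarrow> 'k"
    and t :: "'v \<Rightarrow> 'v \<Rightarrow> 'v \<Rightarrow> 'v"
  assumes quadratic_form: "quadratic_form act q"
    and invertible_nonempty: "invertible_elements q \<noteq> {}"
    and trilinear: "trilinear act t"
    and kirmse: "kirmse act q t"
    and para_associative: "para_associative_on UNIV t"
    and ternary_composition: "ternary_composition q t"

locale commutative_group_spherical_space = group_spherical_space +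
  assumes commutative: "commutative_on UNIV t"

locale torsor =
  fixes S :: "'v set"
    and t :: "'v \<Rightarrow> 'v \<Rightarrow> 'v \<Rightarrow> 'v"
  assumes closed: "\<lbrakk>x \<in> S; y \<in> S; z \<in> S\<rbrakk> \<Longrightarrow> t x y z \<in> S"
    and idempotent_left: "\<lbrakk>x \<in> S; y \<in> S\<rbrakk> \<Longrightarrow> t x x y = y"
    and idempotent_right: "\<lbrakk>x \<in> S; y \<in> S\<rbrakk> \<Longrightarrow> t y x x = y"
    and para_associative: "para_associative_on S t"

locale commutative_torsor = torsor +
  assumes commutative: "commutative_on S t"

definition binary_form :: "'k::comm_ring_1 \<Rightarrow> 'k \<Rightarrow> 'k \<Rightarrow> 'k ^ 2 \<Rightarrow> 'k" where
  "binary_form \<alpha> \<beta> \<gamma> x = \<alpha> * (x $ 1)\<^sup>2 + \<beta> * x $ 1 * x $ 2 + \<gamma> * (x $ 2)\<^sup>2"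

end

theory Submission
  imports Defs "HOL-Analysis.Cartesian_Space"
begin

text \<open>
  Polarising the Kirmse identity in the two equal arguments gives
  \<open>\<langle>x y z\<rangle> + \<langle>y x z\<rangle> = b(x, y) z\<close> with \<open>b\<close> the polar form of \<open>q\<close>. On a basis \<open>e, f\<close> of a plane every
  triple has a repeated entry, and it is adjacent except in \<open>(e, f, e)\<close> and \<open>(f, e, f)\<close>, which are
  reduced to the adjacent case by polarisation. Hence the product is determined by \<open>q\<close>, and
  everything else is a polynomial identity in the coordinates, valid over every commutative ring.
\<close>

text \<open>With \<open>e = axis 1 1\<close> and \<open>f = axis 2 1\<close>, the coefficients are
  the values forced on the basis. A triple with adjacent equal entries gives \<open>\<alpha>\<close>
  or \<open>\<gamma>\<close> times the remaining vector; polarisation gives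
  \<open>\<beta> e - \<alpha> f\<close> for the triple (e, f, e) and
  \<open>\<beta> f - \<gamma> e\<close> for (f, e, f).\<close>

definition binary_triple ::
    "'k::comm_ring_1 \<Rightarrow> 'k \<Rightarrow> 'k \<Rightarrow> 'k ^ 2 \<Rightarrow> 'k ^ 2 \<Rightarrow> 'k ^ 2 \<Rightarrow> 'k ^ 2" where
  "binary_triple \<alpha> \<beta> \<gamma> x y z =
     (\<chi> i. if i = 1
        then \<alpha> * (x$1 * y$1 * z$1) + \<beta> * (x$1 * y$2 * z$1)
           + \<gamma> * (x$1 * y$2 * z$2 + x$2 * y$2 * z$1 - x$2 * y$1 * z$2)
        else \<gamma> * (x$2 * y$2 * z$2) + \<beta> * (x$2 * y$1 * z$2)
           + \<alpha> * (x$2 * y$1 * z$1 + x$1 * y$1 * z$2 - x$1 * y$2 * z$1))"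

lemma binary_triple_nth:
  "binary_triple \<alpha> \<beta> \<gamma> x y z $ 1 = \<alpha> * (x$1 * y$1 * z$1) + \<beta> * (x$1 * y$2 * z$1)
     + \<gamma> * (x$1 * y$2 * z$2 + x$2 * y$2 * z$1 - x$2 * y$1 * z$2)"
  "binary_triple \<alpha> \<beta> \<gamma> x y z $ 2 = \<gamma> * (x$2 * y$2 * z$2) + \<beta> * (x$2 * y$1 * z$2)
     + \<alpha> * (x$2 * y$1 * z$1 + x$1 * y$1 * z$2 - x$1 * y$2 * z$1)"
  by (simp_all add: binary_triple_def)

lemma module_vector_smult: "module ((*s) :: 'k::comm_ring_1 \<Rightarrow> 'k ^ 'n \<Rightarrow> 'k ^ 'n)"
  by standard (simp_all add: vec_eq_iff algebra_simps)

lemma module_self: "module ((*) :: 'k::comm_ring_1 \<Rightarrow> 'k \<Rightarrow> 'k)"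
  by standard (simp_all add: algebra_simps)

lemma quadratic_form_binary_form: "quadratic_form (*s) (binary_form \<alpha> \<beta> \<gamma>)"
  unfolding quadratic_form_def module_hom_def module_hom_axioms_def
  by (auto simp: module_vector_smult module_self binary_form_def algebra_simps power2_eq_square)

lemma trilinear_binary_triple: "trilinear (*s) (binary_triple \<alpha> \<beta> \<gamma>)"
  unfolding trilinear_def module_hom_def module_hom_axioms_def
  by (auto simp: module_vector_smult vec_eq_iff forall_2 binary_triple_nth algebra_simps)

lemma kirmse_binary_triple: "kirmse (*s) (binary_form \<alpha> \<beta> \<gamma>) (binary_triple \<alpha> \<beta> \<gamma>)"
  by (simp add: kirmse_def vec_eq_iff forall_2 binary_triple_nth binary_form_def
      algebra_simps power2_eq_square)

lemma commutative_binary_triple: "commutative_on S (binary_triple \<alpha> \<beta> \<gamma>)"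
  by (simp add: commutative_on_def vec_eq_iff forall_2 binary_triple_nth algebra_simps)

lemma para_associative_binary_triple: "para_associative_on S (binary_triple \<alpha> \<beta> \<gamma>)"
proof -
  have "binary_triple \<alpha> \<beta> \<gamma> a b (binary_triple \<alpha> \<beta> \<gamma> c d e) =
      binary_triple \<alpha> \<beta> \<gamma> a (binary_triple \<alpha> \<beta> \<gamma> d c b) e"
    and "binary_triple \<alpha> \<beta> \<gamma> a (binary_triple \<alpha> \<beta> \<gamma> d c b) e =
      binary_triple \<alpha> \<beta> \<gamma> (binary_triple \<alpha> \<beta> \<gamma> a b c) d e" for a b c d e
    by (simp_all add: vec_eq_iff forall_2 binary_triple_nth algebra_simps)
  then show ?thesis
    unfolding para_associative_on_def by blast
qed

lemma ternary_composition_binary_triple: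
  "ternary_composition (binary_form \<alpha> \<beta> \<gamma>) (binary_triple \<alpha> \<beta> \<gamma>)"
  by (simp add: ternary_composition_def binary_form_def binary_triple_nth power2_eq_square
      algebra_simps)

lemma
  assumes "trilinear act t"
  shows trilinear_add1: "t (x + x') y z = t x y z + t x' y z"
    and trilinear_add2: "t x (y + y') z = t x y z + t x y' z"
    and trilinear_add3: "t x y (z + z') = t x y z + t x y z'"
    and trilinear_scale1: "t (act a x) y z = act a (t x y z)"
    and trilinear_scale2: "t x (act a y) z = act a (t x y z)"
    and trilinear_scale3: "t x y (act a z) = act a (t x y z)"
  using assms unfolding trilinear_def module_hom_def module_hom_axioms_def by blast+

lemma kirmse_polarised:
  assumes "module act" "trilinear act t" "kirmse act q t"
  shows "t x y z = act (q (x + y) - q x - q y) z - t y x z"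
proof -
  interpret module act by fact
  \<comment> \<open>The left side is \<open>act (q (x + y)) z\<close> and the two diagonal terms are
    \<open>act (q x) z\<close> and \<open>act (q y) z\<close>; solving for one mixed term involves
    no division by 2.\<close>
  have "t (x + y) (x + y) z = t x x z + t y x z + (t x y z + t y y z)"
    using assms(2) by (simp add: trilinear_add1 trilinear_add2)
  then show ?thesis
    using assms(3) unfolding kirmse_def by (simp add: algebra_simps)
qed

lemma vec2_eq_axis: "(x :: 'k::comm_ring_1 ^ 2) = x$1 *s axis 1 1 + x$2 *s axis 2 1"
  by (simp add: vec_eq_iff forall_2 axis_def)

lemma trilinear_kirmse_unique:
  fixes q :: "'k::comm_ring_1 ^ 2 \<Rightarrow> 'k"
  assumes t: "trilinear (*s) t" "kirmse (*s) q t" and u: "trilinear (*s) u" "kirmse (*s) q u"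
  shows "t = u"
proof (intro ext)
  fix x y z :: "'k ^ 2"
  have adjacent: "t v v w = u v v w" "t w v v = u w v v" for v w
    using t(2) u(2) by (simp_all add: kirmse_def)
  \<comment> \<open>Polarisation turns the triple (v, w, v) into (w, v, v), whose equal entries are
    adjacent; the scalar depends on \<open>q\<close> alone, so it is the same for \<open>t\<close>
    and \<open>u\<close>.\<close>
  have outer: "t v w v = u v w v" for v w
    using kirmse_polarised[OF module_vector_smult t, of v w v]
      kirmse_polarised[OF module_vector_smult u, of v w v] by (simp add: adjacent)
  \<comment> \<open>Each of the eight basis triples is covered by \<open>adjacent\<close> or
    \<open>outer\<close>. The coefficients are free variables because rewriting with
    \<open>vec2_eq_axis\<close> would loop: its right side contains \<open>x\<close> again.\<close>
  have "t (a *s axis 1 1 + a' *s axis 2 1) (b *s axis 1 1 + b' *s axis 2 1)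
            (c *s axis 1 1 + c' *s axis 2 1) =
        u (a *s axis 1 1 + a' *s axis 2 1) (b *s axis 1 1 + b' *s axis 2 1)
            (c *s axis 1 1 + c' *s axis 2 1)" for a a' b b' c c'
    using t(1) u(1)
    by (simp add: trilinear_add1 trilinear_add2 trilinear_add3 trilinear_scale1 trilinear_scale2
        trilinear_scale3 adjacent outer)
  then show "t x y z = u x y z"
    using vec2_eq_axis[of x] vec2_eq_axis[of y] vec2_eq_axis[of z] by metis
qed

text \<open>Here \<open>d\<close> is the inverse of \<open>c\<close>. On the circle the Kirmse
  identity reads \<open>t x x y = act c y\<close>, so rescaling by \<open>d\<close> makes the
  product idempotent.\<close>

lemma commutative_torsor_circle:
  assumes "quadratic_form act q" "trilinear act t" "kirmse act q t" "para_associative_on UNIV t"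
    "ternary_composition q t" "commutative_on UNIV t" and cd: "c * d = 1"
  shows "commutative_torsor {x. q x = c} (\<lambda>x y z. act d (t x y z))"
proof -
  interpret module act
    using assms(2) unfolding trilinear_def module_hom_def by blast
  have q: "q (act a x) = a\<^sup>2 * q x" for a x
    using assms(1) by (simp add: quadratic_form_def)
  \<comment> \<open>Simplification merges \<open>act d (act c y)\<close> into
    \<open>act (d * c) y\<close>, so the inverse law is needed in this order.\<close>
  have dc: "d * c = 1"
    using cd by (simp add: mult.commute)
  \<comment> \<open>This is the value of \<open>q\<close> at a rescaled product: \<open>d\<close>
    comes out squared, and the composition rule contributes one factor \<open>c\<close> per
    argument.\<close>
  have circle: "d\<^sup>2 * (c * c * c) = c"
  proof -
    have "d\<^sup>2 * (c * c * c) = (c * d) * (c * d) * c"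
      by (simp add: power2_eq_square ac_simps)
    then show ?thesis
      by (simp add: cd)
  qed
  note scale = trilinear_scale1[OF assms(2)] trilinear_scale2[OF assms(2)]
    trilinear_scale3[OF assms(2)]
  show ?thesis
  proof unfold_locales
    show "act d (t x y z) \<in> {x. q x = c}"
      if "x \<in> {x. q x = c}" "y \<in> {x. q x = c}" "z \<in> {x. q x = c}" for x y z
      using that assms(5) circle by (simp add: q ternary_composition_def)
    show "act d (t x x y) = y" "act d (t y x x) = y"
      if "x \<in> {x. q x = c}" "y \<in> {x. q x = c}" for x y
      using that assms(3) by (simp_all add: kirmse_def dc)
    show "para_associative_on {x. q x = c} (\<lambda>x y z. act d (t x y z))"
      \<comment> \<open>Trilinearity pulls the inner \<open>d\<close> out of whichever slot it
        occupies, so all three bracketings carry the same factor, \<open>d\<close> applied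
        twice.\<close>
      using assms(4) unfolding para_associative_on_def scale by (metis UNIV_I)
    show "commutative_on {x. q x = c} (\<lambda>x y z. act d (t x y z))"
      using assms(6) unfolding commutative_on_def by (metis UNIV_I)
  qed
qed

theorem theorem3p1:
  fixes \<alpha> \<beta> \<gamma> :: "'k::comm_ring_1"
    and q :: "'k ^ 2 \<Rightarrow> 'k"
  defines "q \<equiv> binary_form \<alpha> \<beta> \<gamma>"
  shows "(\<exists>!t. trilinear (*s) t \<and> kirmse (*s) q t) \<and>
    (\<forall>t. trilinear (*s) t \<and> kirmse (*s) q t \<longrightarrow>
       commutative_on UNIV t \<and>
       para_associative_on UNIV t \<and>
       ternary_composition q t \<and>
       (invertible_elements q \<noteq> {} \<longrightarrow> commutative_group_spherical_space (*s) q t) \<and>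
       (\<forall>c d. c * d = 1 \<longrightarrow>
          (\<forall>x\<in>{x. q x = c}. \<forall>y\<in>{x. q x = c}. \<forall>z\<in>{x. q x = c}.
             d *s t x y z \<in> {x. q x = c}) \<and>
          commutative_torsor {x. q x = c} (\<lambda>x y z. d *s t x y z)))"
proof -
  let ?t = "binary_triple \<alpha> \<beta> \<gamma>"
  note facts = quadratic_form_binary_form[of \<alpha> \<beta> \<gamma>, folded q_def]
    trilinear_binary_triple[of \<alpha> \<beta> \<gamma>] kirmse_binary_triple[of \<alpha> \<beta> \<gamma>, folded q_def]
    para_associative_binary_triple[of UNIV \<alpha> \<beta> \<gamma>]
    ternary_composition_binary_triple[of \<alpha> \<beta> \<gamma>, folded q_def]
    commutative_binary_triple[of UNIV \<alpha> \<beta> \<gamma>]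
  have unique: "t = ?t" if "trilinear (*s) t \<and> kirmse (*s) q t" for t
    using that facts(2,3) trilinear_kirmse_unique by blast
  have "commutative_group_spherical_space (*s) q ?t" if "invertible_elements q \<noteq> {}"
    using facts that
    by (simp add: commutative_group_spherical_space_def group_spherical_space_def
        commutative_group_spherical_space_axioms_def group_spherical_space_axioms_def
        module_vector_smult)
  moreover have circle: "commutative_torsor {x. q x = c} (\<lambda>x y z. d *s ?t x y z)"
    if "c * d = 1" for c d
    using commutative_torsor_circle[OF facts that] .
  moreover have "\<forall>x\<in>{x. q x = c}. \<forall>y\<in>{x. q x = c}. \<forall>z\<in>{x. q x = c}.
      d *s ?t x y z \<in> {x. q x = c}" if "c * d = 1" for c d
    using torsor.closed[OF commutative_torsor.axioms(1)[OF circle[OF that]]] by blast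
  ultimately show ?thesis
    using facts unique by (intro conjI ex1I[of _ ?t] allI impI) (blast | metis unique)+
qed

end
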